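(* Let $P$ be a finite poset, $K$ a finite simplicial complex, $\mathsf{F} : P \to \mathsf{SubCx}(K)$ a filtration and $\rho\ge 0$ an integer. Then, for any $b<d$ in $P$, the map $$\mathsf{OI}(\mathsf{ZB}_\rho^{\mathsf{F}})((b,d)) \to P_\rho^{b,d}(\mathsf{F}) = \frac{M_\rho^{b,d}(\mathsf{F})}{N_\rho^{b,d}(\mathsf{F})},\qquad z\mapsto [z]+N_\rho^{b,d}(\mathsf{F}),$$ is a surjection, where $[z]=z+\mathsf{B}_\rho(\mathsf{F}(b))$ is the homology class of $z$ in $H_\rho(\mathsf{F}(b))$.
   Context: Segments: $\mathsf{Seg}(P)$ consists of all pairs $(b,d)$ with $b\le d$ in $P$ (including $(a,a)$) together with a pair $(a,\infty)$ for each $a\in P$. The product order is $(b_1,d_1)\le_\times(b_2,d_2)\iff b_1\le b_2$ and $d_1\le d_2$, where $p<\infty$ for all $p\in P$. Chains: for a finite simplicial complex $K$ over a finite totally ordered vertex set, $C_\rho^K$ is the real vector space with basis the oriented $\rho$-simplices of $K$ (oriented by the vertex order), with the inner product making this basis orthonormal, and the usual simplicial boundary operators. For a subcomplex $L\subseteq K$, $\mathsf{Z}_\rho(L)$ and $\mathsf{B}_\rho(L)$ are the spaces of $\rho$-cycles and $\rho$-boundaries of $L$, viewed as subspaces of $C_\rho^K$, and $H_\rho(L)=\mathsf{Z}_\rho(L)/\mathsf{B}_\rho(L)$. $\mathsf{SubCx}(K)$ is the poset of subcomplexes of $K$ under inclusion; a filtration is an order-preserving map $\mathsf{F}:P\to\mathsf{SubCx}(K)$.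 Birth-death spaces: $\mathsf{ZB}_\rho^{\mathsf{F}}((b,d)) := \mathsf{Z}_\rho(\mathsf{F}(b))\cap\mathsf{B}_\rho(\mathsf{F}(d))$ for $b\le d$ in $P$, and $\mathsf{ZB}_\rho^{\mathsf{F}}((b,\infty)) := \mathsf{Z}_\rho(\mathsf{F}(b))$. Orthogonal Inverse: $\mathsf{OI}(\mathsf{ZB}_\rho^{\mathsf{F}})((b,d)) := \mathsf{ZB}_\rho^{\mathsf{F}}((b,d))\cap\big(\sum_{(a,c)<_\times(b,d)}\mathsf{ZB}_\rho^{\mathsf{F}}((a,c))\big)^\perp$ (empty sum is $\{0\}$; $\perp$ in $C_\rho^K$). Let $\iota_\rho^{b,d} : H_\rho(\mathsf{F}(b))\to H_\rho(\mathsf{F}(d))$ be the map induced by inclusion and $H_\rho^{b,d}(\mathsf{F}) := \mathrm{im}(\iota_\rho^{b,d})$, for $b\le d$ in $P$. Define $$M_\rho^{b,d}(\mathsf{F}) := \sum_{b'<b}(\iota_\rho^{b,d})^{-1}\big(H_\rho^{b',d}(\mathsf{F})\big)\subseteq H_\rho(\mathsf{F}(b))\quad (b\le d),$$ $$N_\rho^{b,d}(\mathsf{F}) := \sum_{b\le d'<d}M_\rho^{b,d'}(\mathsf{F}),\qquad P_\rho^{b,d}(\mathsf{F}) := M_\rho^{b,d}(\mathsf{F})/N_\rho^{b,d}(\mathsf{F})\quad (b<d).$$ When $b$ is a minimal element of $P$, the convention is $M_\rho^{b,d}(\mathsf{F}) := \ker(\iota_\rho^{b,d})$, and correspondingly $N_\rho^{b,d}(\mathsf{F})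 = \sum_{b\le d'<d}\ker(\iota_\rho^{b,d'})$. *)

theory Defs
  imports "HOL-Analysis.Analysis" "HOL-Library.Set_Algebras" "HOL-Library.Product_Order"
    "HOL-Library.Lattice_Constructions"
begin

section \<open>Segments\<close>

text \<open>The point at infinity is the constructor \<open>top.Top\<close> of the library type \<open>'p top\<close>. The product
  order is the order on pairs from \<open>Product_Order\<close>; its strict part is
  \<open>s \<le> t \<and> \<not> t \<le> s\<close>.\<close>

type_synonym 'p segment = "'p \<times> 'p top"

definition Seg :: "'p::order segment set" where
  "Seg = {(b, top.Value d) | b d. b \<le> d} \<union> {(a, top.Top) | a. True}"

text \<open>Orthogonal inverse of a family of subspaces of the inner product space \<open>V\<close>. The sum over
  strictly smaller segments is the sum of sets from \<open>Set_Algebras\<close>, so the empty sum is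
  \<open>{0}\<close>; it is only meaningful over a finite poset.\<close>

definition OI :: "'a::real_inner set \<Rightarrow> ('p::order segment \<Rightarrow> 'a set) \<Rightarrow> 'p segment \<Rightarrow> 'a set" where
  "OI V \<Phi> s = \<Phi> s \<inter> {x \<in> V. \<forall>y \<in> (\<Sum>t \<in> {t \<in> Seg. t < s}. \<Phi> t). orthogonal y x}"


section \<open>Simplicial complexes and filtrations\<close>

definition abstract_simplicial_complex :: "'v set set \<Rightarrow> bool" where
  "abstract_simplicial_complex K \<longleftrightarrow>
     (\<forall>\<sigma>\<in>K. finite \<sigma> \<and> \<sigma> \<noteq> {}) \<and> (\<forall>\<sigma>\<in>K. \<forall>\<tau>. \<tau> \<noteq> {} \<and> \<tau> \<subseteq> \<sigma> \<longrightarrow> \<tau> \<in> K)"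

definition SubCx :: "'v set set \<Rightarrow> 'v set set set" where
  "SubCx K = {L. abstract_simplicial_complex L \<and> L \<subseteq> K}"

definition filtration :: "'v set set \<Rightarrow> ('p::order \<Rightarrow> 'v set set) \<Rightarrow> bool" where
  "filtration K F \<longleftrightarrow> range F \<subseteq> SubCx K \<and> mono F"


section \<open>Chains, cycles and boundaries\<close>

text \<open>All chains live in the Euclidean space with one coordinate for each set of vertices, so
  that the chain spaces of a complex and of its subcomplexes are subspaces of one space, and the
  simplices, oriented by the vertex order and represented by the standard unit vectors, are
  orthonormal.\<close>

type_synonym 'v chain = "real ^ ('v set)"

definition simplices :: "nat \<Rightarrow> 'v set set \<Rightarrow> 'v set set" where
  "simplices \<rho> K = {\<sigma> \<in> K. card \<sigma> = Suc \<rho>}"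

definition chain_space :: "nat \<Rightarrow> 'v::finite set set \<Rightarrow> 'v chain set" where
  "chain_space \<rho> K = span ((\<lambda>\<sigma>. axis \<sigma> 1) ` simplices \<rho> K)"

text \<open>Boundary of the simplex with vertices \<open>v\<^sub>0 < \<dots> < v\<^sub>k\<close>; vertices have zero boundary.\<close>

definition simplex_boundary :: "'v::{finite,linorder} set \<Rightarrow> 'v chain" where
  "simplex_boundary \<sigma> =
     (if card \<sigma> \<le> 1 then 0
      else \<Sum>i<card \<sigma>. (-1) ^ i *\<^sub>R axis (\<sigma> - {sorted_list_of_set \<sigma> ! i}) 1)"

text \<open>The boundary operators of all degrees, extended linearly, at once.\<close>

definition boundary :: "'v::{finite,linorder} chain \<Rightarrow> 'v chain" where
  "boundary c = (\<Sum>\<sigma>\<in>UNIV. (c $ \<sigma>) *\<^sub>R simplex_boundary \<sigma>)"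

definition cycles :: "nat \<Rightarrow> 'v::{finite,linorder} set set \<Rightarrow> 'v chain set" where
  "cycles \<rho> L = {c \<in> chain_space \<rho> L. boundary c = 0}"

definition boundaries :: "nat \<Rightarrow> 'v::{finite,linorder} set set \<Rightarrow> 'v chain set" where
  "boundaries \<rho> L = boundary ` chain_space (Suc \<rho>) L"

definition ZB ::
  "nat \<Rightarrow> ('p::order \<Rightarrow> 'v::{finite,linorder} set set) \<Rightarrow> 'p segment \<Rightarrow> 'v chain set" where
  "ZB \<rho> F s = (case s of (b, e) \<Rightarrow>
     (case e of top.Value d \<Rightarrow> cycles \<rho> (F b) \<inter> boundaries \<rho> (F d)
              | top.Top \<Rightarrow> cycles \<rho> (F b)))"


section \<open>Homology\<close>

text \<open>Quotients consist of cosets, with \<open>+o\<close> and \<open>+\<close> from \<open>Set_Algebras\<close>: the sum of the cosets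
  \<open>x +o W\<close> and \<open>y +o W\<close> is their sum as sets. The same definition applies to a quotient
  of subspaces of a quotient, whose elements are then sets of cosets.\<close>

definition quotient_space :: "'a::comm_monoid_add set \<Rightarrow> 'a set \<Rightarrow> 'a set set" where
  "quotient_space V W = (\<lambda>v. v +o W) ` V"

definition homology_class ::
  "nat \<Rightarrow> 'v::{finite,linorder} set set \<Rightarrow> 'v chain \<Rightarrow> 'v chain set" where
  "homology_class \<rho> L z = z +o boundaries \<rho> L"

definition homology :: "nat \<Rightarrow> 'v::{finite,linorder} set set \<Rightarrow> 'v chain set set" where
  "homology \<rho> L = quotient_space (cycles \<rho> L) (boundaries \<rho> L)"

text \<open>The map to the homology of \<open>L\<close> induced by the inclusion of a subcomplex of \<open>L\<close>: all
  representatives of a class lie in the same coset of the boundaries of \<open>L\<close>. Its effect on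
  classes is \<open>inclusion_map_class\<close> below.\<close>

definition inclusion_map ::
  "nat \<Rightarrow> 'v::{finite,linorder} set set \<Rightarrow> 'v chain set \<Rightarrow> 'v chain set" where
  "inclusion_map \<rho> L h = h + boundaries \<rho> L"

definition persistent_homology ::
  "nat \<Rightarrow> ('p::order \<Rightarrow> 'v::{finite,linorder} set set) \<Rightarrow> 'p \<Rightarrow> 'p \<Rightarrow> 'v chain set set" where
  "persistent_homology \<rho> F b d = inclusion_map \<rho> (F d) ` homology \<rho> (F b)"

definition ker_inclusion ::
  "nat \<Rightarrow> ('p::order \<Rightarrow> 'v::{finite,linorder} set set) \<Rightarrow> 'p \<Rightarrow> 'p \<Rightarrow> 'v chain set set" where
  "ker_inclusion \<rho> F b d = {h \<in> homology \<rho> (F b).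
     inclusion_map \<rho> (F d) h = homology_class \<rho> (F d) 0}"

text \<open>Both index sets below are nonempty where it matters (\<open>b\<close> not minimal, respectively
  \<open>b < d\<close>), so the sums of sets are the sums of subspaces of the homology of \<open>F b\<close>.\<close>

definition M_space ::
  "nat \<Rightarrow> ('p::order \<Rightarrow> 'v::{finite,linorder} set set) \<Rightarrow> 'p \<Rightarrow> 'p \<Rightarrow> 'v chain set set" where
  "M_space \<rho> F b d =
     (if \<exists>b'. b' < b
      then \<Sum>b' \<in> {b'. b' < b}.
             {h \<in> homology \<rho> (F b).
               inclusion_map \<rho> (F d) h \<in> persistent_homology \<rho> F b' d}
      else ker_inclusion \<rho> F b d)"

definition N_space ::
  "nat \<Rightarrow> ('p::order \<Rightarrow> 'v::{finite,linorder} set set) \<Rightarrow> 'p \<Rightarrow> 'p \<Rightarrow> 'v chain set set" where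
  "N_space \<rho> F b d = (\<Sum>d' \<in> {d'. b \<le> d' \<and> d' < d}. M_space \<rho> F b d')"

definition P_space ::
  "nat \<Rightarrow> ('p::order \<Rightarrow> 'v::{finite,linorder} set set) \<Rightarrow> 'p \<Rightarrow> 'p \<Rightarrow> 'v chain set set set" where
  "P_space \<rho> F b d = quotient_space (M_space \<rho> F b d) (N_space \<rho> F b d)"


section \<open>Compatibility of the coset operations\<close>

lemma linear_boundary: "linear boundary"
  unfolding boundary_def
  by (rule linearI) (simp_all add: scaleR_left_distrib sum.distrib scaleR_sum_right)

lemma subspace_chain_space: "subspace (chain_space \<rho> L)"
  by (simp add: chain_space_def subspace_span)

lemma chain_space_mono: "L \<subseteq> L' \<Longrightarrow> chain_space \<rho> L \<subseteq> chain_space \<rho> L'"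
  unfolding chain_space_def simplices_def by (intro span_mono image_mono) auto

lemma subspace_boundaries: "subspace (boundaries \<rho> L)"
  unfolding boundaries_def
  by (intro linear_subspace_image linear_boundary subspace_chain_space)

lemma boundaries_mono: "L \<subseteq> L' \<Longrightarrow> boundaries \<rho> L \<subseteq> boundaries \<rho> L'"
  unfolding boundaries_def by (intro image_mono chain_space_mono)

lemma subspace_cycles: "subspace (cycles \<rho> L)"
proof -
  have "cycles \<rho> L = chain_space \<rho> L \<inter> {c. boundary c = 0}"
    by (auto simp: cycles_def)
  then show ?thesis
    by (simp add: subspace_inter subspace_chain_space linear_subspace_kernel linear_boundary)
qed

lemma subspace_plus_absorb:
  assumes "subspace W" "U \<subseteq> W" "0 \<in> U"
  shows "U + W = W"
proof
  show "U + W \<subseteq> W"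
    using assms by (auto elim!: set_plus_elim intro: subspace_add)
  show "W \<subseteq> U + W"
    using set_plus_intro[OF assms(3)] by fastforce
qed

lemma homology_class_add:
  "homology_class \<rho> L x + homology_class \<rho> L y = homology_class \<rho> L (x + y)"
proof -
  have "boundaries \<rho> L + boundaries \<rho> L = boundaries \<rho> L"
    by (intro subspace_plus_absorb subspace_boundaries order_refl subspace_0)
  then show ?thesis
    by (simp only: homology_class_def set_plus_rearrange)
qed

lemma inclusion_map_class:
  assumes "L \<subseteq> L'"
  shows "inclusion_map \<rho> L' (homology_class \<rho> L z) = homology_class \<rho> L' z"
proof -
  have "boundaries \<rho> L + boundaries \<rho> L' = boundaries \<rho> L'"
    by (intro subspace_plus_absorb subspace_boundaries boundaries_mono assms subspace_0)
  then show ?thesis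
    by (simp only: inclusion_map_def homology_class_def set_plus_rearrange3)
qed

end

theory Submission
  imports Defs
begin

text \<open>Pull everything back from homology to chains. Let \<open>\<pi>\<close> be the projection from the cycles of
  \<open>F b\<close> to homology, let \<open>S\<close> be the sum of the cycle spaces \<open>Z(F b')\<close> with \<open>b' < b\<close>, and write
  \<open>ZB(b, d)\<close> for the cycles of \<open>F b\<close> that bound in \<open>F d\<close>. A cycle \<open>z\<close> of \<open>F b\<close> becomes homologous
  in \<open>F d\<close> to a cycle \<open>z'\<close> of \<open>F b'\<close> exactly when \<open>z - z'\<close> lies in \<open>ZB(b, d)\<close>.
  Hence \<open>M = \<pi>(S + ZB(b, d))\<close>, and \<open>N = \<pi>(W)\<close>, where \<open>W\<close> is the sum of \<open>S\<close> and all
  \<open>ZB(b, d')\<close> with \<open>b \<le> d' < d\<close>. The convention for minimal \<open>b\<close> is the same formula with \<open>S = 0\<close>.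
  These are the lemmas \<open>M_space_eq_image\<close> and \<open>N_space_eq_image\<close>.

  Now let \<open>T\<close> be the sum of the \<open>ZB(a, c)\<close> over the segments \<open>(a, c)\<close> strictly below \<open>(b, d)\<close>.
  Such a segment has either \<open>a < b\<close>, and then \<open>ZB(a, c) \<subseteq> S\<close>, or \<open>a = b\<close> and \<open>b \<le> c < d\<close>, and
  then \<open>ZB(a, c)\<close> is one of the summands of \<open>W\<close>. So \<open>T \<subseteq> W\<close>, and \<open>T \<subseteq> ZB(b, d)\<close> by
  monotonicity. A class of \<open>M/N\<close> is represented by some \<open>w\<close> in \<open>ZB(b, d)\<close>, because \<open>S \<subseteq> W\<close>.
  Splitting off the orthogonal projection of \<open>w\<close> to \<open>T\<close> leaves an element of the orthogonal
  inverse and changes \<open>w\<close> only by an element of \<open>W\<close>.\<close>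

section \<open>Sums of subspaces as sums of sets\<close>

lemma subspace_set_plus:
  assumes "subspace U" "subspace W"
  shows "subspace (U + W)"
proof -
  have "U + W = {x + y |x y. x \<in> U \<and> y \<in> W}"
    by (auto simp: set_plus_def)
  then show ?thesis
    using subspace_sums[OF assms] by simp
qed

lemma subspace_set_sum:
  fixes A :: "'i \<Rightarrow> 'a::real_vector set"
  assumes "\<And>i. i \<in> I \<Longrightarrow> subspace (A i)"
  shows "subspace (\<Sum>i\<in>I. A i)"
  using assms
  by (induction I rule: infinite_finite_induct)
     (auto intro: subspace_set_plus subspace_single_0)

lemma set_sum_subset_subspace:
  fixes A :: "'i \<Rightarrow> 'a::real_vector set"
  assumes "subspace W" "\<And>i. i \<in> I \<Longrightarrow> A i \<subseteq> W"
  shows "(\<Sum>i\<in>I. A i) \<subseteq> W"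
  using assms(2)
proof (induction I rule: infinite_finite_induct)
  case (insert i I)
  then have "A i + (\<Sum>i\<in>I. A i) \<subseteq> W + W"
    by (intro set_plus_mono2) auto
  also have "\<dots> = W"
    by (intro subspace_plus_absorb assms order_refl subspace_0)
  finally show ?case
    using insert by simp
qed (auto simp: assms(1) subspace_0)

lemma subset_set_plus_left: "0 \<in> B \<Longrightarrow> A \<subseteq> A + (B::'a::comm_monoid_add set)"
  using set_plus_intro[of _ A 0 B] by auto

lemma subset_set_plus_right: "0 \<in> A \<Longrightarrow> B \<subseteq> A + (B::'a::comm_monoid_add set)"
  using set_plus_intro[of 0 A _ B] by auto

lemma summand_subset_set_sum:
  fixes A :: "'i \<Rightarrow> 'a::real_vector set"
  assumes "finite I" "i \<in> I" "\<And>j. j \<in> I \<Longrightarrow> subspace (A j)"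
  shows "A i \<subseteq> (\<Sum>j\<in>I. A j)"
proof -
  have "0 \<in> (\<Sum>j\<in>I - {i}. A j)"
    using assms by (intro subspace_0 subspace_set_sum) auto
  then have "A i \<subseteq> A i + (\<Sum>j\<in>I - {i}. A j)"
    by (rule subset_set_plus_left)
  then show ?thesis
    using assms by (simp add: sum.remove)
qed

lemma set_sum_const_subspace:
  fixes W :: "'a::real_vector set"
  assumes "finite I" "I \<noteq> {}" "subspace W"
  shows "(\<Sum>i\<in>I. W) = W"
  using assms set_sum_subset_subspace[of W I "\<lambda>_. W"] summand_subset_set_sum[of I _ "\<lambda>_. W"]
  by blast

lemma coset_eq_iff_diff_mem:
  fixes W :: "'a::real_vector set"
  assumes "subspace W"
  shows "x +o W = y +o W \<longleftrightarrow> x - y \<in> W"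
proof
  assume "x +o W = y +o W"
  then have "x \<in> y +o W"
    using set_plus_intro2[OF subspace_0[OF assms], of x] by simp
  then show "x - y \<in> W"
    by (auto simp: elt_set_plus_def)
next
  assume xy: "x - y \<in> W"
  have "x + w \<in> y +o W" "y + w \<in> x +o W" if "w \<in> W" for w
    using subspace_add[OF assms xy that] subspace_diff[OF assms that xy]
    by (force simp: elt_set_plus_def algebra_simps)+
  then show "x +o W = y +o W"
    by (auto simp: elt_set_plus_def)
qed

section \<open>Images under the projection to homology\<close>

lemma homology_class_image_plus:
  "homology_class \<rho> L ` (A + B) = homology_class \<rho> L ` A + homology_class \<rho> L ` B"
proof -
  have "homology_class \<rho> L ` A + homology_class \<rho> L ` B
      = {homology_class \<rho> L x + homology_class \<rho> L y |x y. x \<in> A \<and> y \<in> B}"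
    unfolding set_plus_def[of "homology_class \<rho> L ` A"] by blast
  also have "\<dots> = {homology_class \<rho> L (x + y) |x y. x \<in> A \<and> y \<in> B}"
    by (simp only: homology_class_add)
  also have "\<dots> = homology_class \<rho> L ` (A + B)"
    unfolding set_plus_def by blast
  finally show ?thesis ..
qed

text \<open>Nonemptiness matters: for empty \<open>I\<close> the left-hand side consists of the coset of \<open>0\<close>, while
  the empty sum on the right consists of the set \<open>{0}\<close>, which is the neutral element for sums of
  sets but in general not a homology class.\<close>

lemma homology_class_image_sum:
  assumes "finite I" "I \<noteq> {}"
  shows "homology_class \<rho> L ` (\<Sum>i\<in>I. A i) = (\<Sum>i\<in>I. homology_class \<rho> L ` A i)"
  using assms by (induction I rule: finite_ne_induct)
    (simp_all add: homology_class_image_plus del: set_zero)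

text \<open>This turns a coset in the quotient \<open>M/N\<close>, a set of homology classes, into the image of a coset
  of chains, so that cosets can be compared at the level of chains.\<close>

lemma homology_class_coset_image:
  "homology_class \<rho> L x +o homology_class \<rho> L ` W = homology_class \<rho> L ` (x +o W)"
proof -
  have coset: "a +o B = (+) a ` B" for a :: "'b::plus" and B
    by (auto simp: elt_set_plus_def)
  show ?thesis
    by (simp add: coset image_image homology_class_add)
qed

section \<open>Birth-death spaces of a filtration\<close>

lemma ZB_Value: "ZB \<rho> F (b, top.Value d) = cycles \<rho> (F b) \<inter> boundaries \<rho> (F d)"
  by (simp add: ZB_def)

lemma subspace_ZB: "subspace (ZB \<rho> F s)"
  by (auto simp: ZB_def subspace_inter subspace_cycles subspace_boundaries
           split: prod.split top.split)

lemma cycles_mono: "L \<subseteq> L' \<Longrightarrow> cycles \<rho> L \<subseteq> cycles \<rho> L'"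
  using chain_space_mono[of L L' \<rho>] by (auto simp: cycles_def)

definition earlier_cycles ::
  "nat \<Rightarrow> ('p::order \<Rightarrow> 'v::{finite,linorder} set set) \<Rightarrow> 'p \<Rightarrow> 'v chain set" where
  "earlier_cycles \<rho> F b = (\<Sum>b'\<in>{b'. b' < b}. cycles \<rho> (F b'))"

lemma subspace_earlier_cycles: "subspace (earlier_cycles \<rho> F b)"
  by (simp add: earlier_cycles_def subspace_set_sum subspace_cycles)

lemma cycles_subset_earlier_cycles:
  fixes b :: "'p::{finite,order}"
  assumes "a < b"
  shows "cycles \<rho> (F a) \<subseteq> earlier_cycles \<rho> F b"
  unfolding earlier_cycles_def
  by (rule summand_subset_set_sum) (use assms in \<open>auto simp: subspace_cycles\<close>)

text \<open>An earlier birth puts the birth-death space of \<open>t\<close> into the earlier cycles; an equal birth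
  forces a strictly earlier death and so makes it a summand of \<open>N\<close>. Infinite deaths do not occur
  below a finite one.\<close>

lemma segment_below_Value_cases:
  assumes "t \<in> Seg" "t < (b, top.Value d)"
  obtains a c where "t = (a, top.Value c)" "a < b" "c \<le> d"
    | c where "t = (b, top.Value c)" "b \<le> c" "c < d"
proof -
  obtain a e where t: "t = (a, e)"
    by fastforce
  have le: "a \<le> b" "e \<le> top.Value d" and nle: "\<not> (b \<le> a \<and> top.Value d \<le> e)"
    using assms(2) by (simp_all add: t less_prod_def)
  obtain c where c: "e = top.Value c" "a \<le> c" "c \<le> d"
    using assms(1) le(2) by (cases e) (auto simp: t Seg_def)
  then have "(a < b \<and> c \<le> d) \<or> (a = b \<and> c < d)"
    using le nle by (auto simp: less_le_not_le)
  then show ?thesis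
    using that t c by blast
qed

section \<open>The spaces M and N as images of spaces of cycles\<close>

text \<open>Correcting a cycle by a cycle of \<open>F b'\<close> to which it is homologous in \<open>F d\<close> leaves a cycle
  that bounds in \<open>F d\<close>.\<close>

lemma preimage_persistent_homology:
  assumes "mono F" "b' \<le> b" "b \<le> d"
  shows "{h \<in> homology \<rho> (F b). inclusion_map \<rho> (F d) h \<in> persistent_homology \<rho> F b' d}
       = homology_class \<rho> (F b) ` (cycles \<rho> (F b') + ZB \<rho> F (b, top.Value d))"
    (is "?L = _")
proof -
  have sub: "F b' \<subseteq> F b" "F b \<subseteq> F d" "F b' \<subseteq> F d"
    using assms by (auto dest: monoD order_trans)
  have hom: "homology \<rho> L = homology_class \<rho> L ` cycles \<rho> L" for L :: "'b set set"
    by (simp add: homology_def quotient_space_def homology_class_def[abs_def])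
  have per: "persistent_homology \<rho> F b' d = homology_class \<rho> (F d) ` cycles \<rho> (F b')"
    by (simp add: persistent_homology_def hom image_image inclusion_map_class sub)
  have eq: "homology_class \<rho> (F d) z = homology_class \<rho> (F d) z' \<longleftrightarrow> z - z' \<in> boundaries \<rho> (F d)"
    for z z'
    by (simp add: homology_class_def coset_eq_iff_diff_mem subspace_boundaries)
  have split: "(\<exists>z'\<in>cycles \<rho> (F b'). z - z' \<in> boundaries \<rho> (F d))
      \<longleftrightarrow> z \<in> cycles \<rho> (F b') + ZB \<rho> F (b, top.Value d)" if "z \<in> cycles \<rho> (F b)" for z
  proof
    assume "\<exists>z'\<in>cycles \<rho> (F b'). z - z' \<in> boundaries \<rho> (F d)"
    then obtain z' where z': "z' \<in> cycles \<rho> (F b')" "z - z' \<in> boundaries \<rho> (F d)"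
      by blast
    then have "z - z' \<in> cycles \<rho> (F b)"
      using cycles_mono[OF sub(1)] that by (blast intro: subspace_diff subspace_cycles)
    then have "z' + (z - z') \<in> cycles \<rho> (F b') + ZB \<rho> F (b, top.Value d)"
      using z' by (intro set_plus_intro) (auto simp: ZB_Value)
    then show "z \<in> cycles \<rho> (F b') + ZB \<rho> F (b, top.Value d)"
      by simp
  qed (force simp: ZB_Value elim!: set_plus_elim)
  have le: "cycles \<rho> (F b') + ZB \<rho> F (b, top.Value d) \<subseteq> cycles \<rho> (F b)"
    using cycles_mono[OF sub(1)]
    by (auto simp: ZB_Value elim!: set_plus_elim intro: subspace_add subspace_cycles)
  have "?L = homology_class \<rho> (F b) `
      {z \<in> cycles \<rho> (F b). \<exists>z'\<in>cycles \<rho> (F b'). z - z' \<in> boundaries \<rho> (F d)}"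
    unfolding hom per
  proof (intro equalityI subsetI; elim imageE CollectE conjE)
    fix h z z'
    assume h: "h = homology_class \<rho> (F b) z" "z \<in> cycles \<rho> (F b)"
      and z': "inclusion_map \<rho> (F d) h = homology_class \<rho> (F d) z'" "z' \<in> cycles \<rho> (F b')"
    then have "z - z' \<in> boundaries \<rho> (F d)"
      by (simp add: inclusion_map_class sub eq)
    then show "h \<in> homology_class \<rho> (F b) `
        {z \<in> cycles \<rho> (F b). \<exists>z'\<in>cycles \<rho> (F b'). z - z' \<in> boundaries \<rho> (F d)}"
      using h z' by blast
  qed (auto simp: inclusion_map_class sub eq image_iff)
  moreover have "{z \<in> cycles \<rho> (F b). \<exists>z'\<in>cycles \<rho> (F b'). z - z' \<in> boundaries \<rho> (F d)}
      = cycles \<rho> (F b') + ZB \<rho> F (b, top.Value d)"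
    using split le by blast
  ultimately show ?thesis
    by simp
qed

lemma ker_inclusion_eq_image:
  assumes "mono F" "b \<le> d"
  shows "ker_inclusion \<rho> F b d = homology_class \<rho> (F b) ` ZB \<rho> F (b, top.Value d)"
proof -
  have "F b \<subseteq> F d"
    using assms by (rule monoD)
  moreover have "homology \<rho> (F b) = homology_class \<rho> (F b) ` cycles \<rho> (F b)"
    by (simp add: homology_def quotient_space_def homology_class_def[abs_def])
  moreover have "homology_class \<rho> (F d) z = homology_class \<rho> (F d) 0 \<longleftrightarrow> z \<in> boundaries \<rho> (F d)" for z
    using coset_eq_iff_diff_mem[OF subspace_boundaries, of z \<rho> "F d" 0]
    by (simp add: homology_class_def)
  ultimately have "ker_inclusion \<rho> F b d
      = homology_class \<rho> (F b) ` {z \<in> cycles \<rho> (F b). z \<in> boundaries \<rho> (F d)}"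
    unfolding ker_inclusion_def
    by (simp add: Compr_image_eq inclusion_map_class del: set_zero)
  then show ?thesis
    by (simp add: ZB_Value Int_def)
qed

text \<open>The summand \<open>ZB(b, d)\<close> occurs once for each \<open>b' < b\<close> in the definition, and all these copies
  collapse into one because it is a subspace. For minimal \<open>b\<close> there are no earlier cycles, and the
  formula gives the kernel, as the convention requires.\<close>

lemma M_space_eq_image:
  fixes F :: "'p::{finite,order} \<Rightarrow> 'v::{finite,linorder} set set"
  assumes "mono F" "b \<le> d"
  shows "M_space \<rho> F b d
       = homology_class \<rho> (F b) ` (earlier_cycles \<rho> F b + ZB \<rho> F (b, top.Value d))"
proof (cases "\<exists>b'. b' < b")
  case True
  then have ne: "{b'. b' < b} \<noteq> {}"
    by simp
  have "M_space \<rho> F b d = (\<Sum>b'\<in>{b'. b' < b}.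
      homology_class \<rho> (F b) ` (cycles \<rho> (F b') + ZB \<rho> F (b, top.Value d)))"
    using True assms by (simp add: M_space_def preimage_persistent_homology)
  also have "\<dots> = homology_class \<rho> (F b) `
      (\<Sum>b'\<in>{b'. b' < b}. cycles \<rho> (F b') + ZB \<rho> F (b, top.Value d))"
    using ne by (simp add: homology_class_image_sum)
  finally show ?thesis
    using ne by (simp add: sum.distrib set_sum_const_subspace subspace_ZB earlier_cycles_def)
next
  case False
  then have "earlier_cycles \<rho> F b = 0"
    by (simp add: earlier_cycles_def del: set_zero)
  then show ?thesis
    using False assms by (simp add: M_space_def ker_inclusion_eq_image del: set_zero)
qed

lemma N_space_eq_image:
  fixes F :: "'p::{finite,order} \<Rightarrow> 'v::{finite,linorder} set set"
  assumes "mono F" "b < d"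
  shows "N_space \<rho> F b d = homology_class \<rho> (F b) `
    (earlier_cycles \<rho> F b + (\<Sum>d'\<in>{d'. b \<le> d' \<and> d' < d}. ZB \<rho> F (b, top.Value d')))"
proof -
  have ne: "{d'. b \<le> d' \<and> d' < d} \<noteq> {}"
    using assms by auto
  have "N_space \<rho> F b d = homology_class \<rho> (F b) `
      (\<Sum>d'\<in>{d'. b \<le> d' \<and> d' < d}. earlier_cycles \<rho> F b + ZB \<rho> F (b, top.Value d'))"
    using ne assms by (simp add: N_space_def M_space_eq_image homology_class_image_sum)
  then show ?thesis
    using ne by (simp add: sum.distrib set_sum_const_subspace subspace_earlier_cycles)
qed

section \<open>Surjectivity\<close>

theorem theorem6:
  fixes K :: "'v::{finite,linorder} set set"
    and F :: "'p::{finite,order} \<Rightarrow> 'v set set"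
    and \<rho> :: nat
    and b d :: 'p
  assumes "abstract_simplicial_complex K"
    and "filtration K F"
    and "b < d"
  shows "(\<lambda>z. homology_class \<rho> (F b) z +o N_space \<rho> F b d)
           ` OI (chain_space \<rho> K) (ZB \<rho> F) (b, top.Value d)
         = P_space \<rho> F b d"
proof -
  let ?\<pi> = "homology_class \<rho> (F b)"
  define O' where "O' = OI (chain_space \<rho> K) (ZB \<rho> F) (b, top.Value d)"
  define S where "S = earlier_cycles \<rho> F b"
  define D where "D = ZB \<rho> F (b, top.Value d)"
  define E where "E = (\<Sum>d'\<in>{d'. b \<le> d' \<and> d' < d}. ZB \<rho> F (b, top.Value d'))"
  define T where "T = (\<Sum>t\<in>{t \<in> Seg. t < (b, top.Value d)}. ZB \<rho> F t)"
  have mono: "mono F" and FK: "F b \<subseteq> K"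
    using assms(2) by (auto simp: filtration_def SubCx_def)
  have sub: "subspace S" "subspace D" "subspace E" "subspace T" "subspace (S + E)"
    by (auto simp: S_def D_def E_def T_def
             intro!: subspace_earlier_cycles subspace_ZB subspace_set_sum subspace_set_plus)
  have M: "M_space \<rho> F b d = ?\<pi> ` (S + D)" and N: "N_space \<rho> F b d = ?\<pi> ` (S + E)"
    using mono assms(3) by (simp_all add: M_space_eq_image N_space_eq_image S_def D_def E_def)
  have S_le: "S \<subseteq> S + E" and E_le: "E \<subseteq> S + E" and D_le: "D \<subseteq> S + D"
    using sub by (auto intro: subset_set_plus_left subset_set_plus_right subspace_0 del: subsetI)
  \<comment> \<open>The birth-death spaces below \<open>(b, d)\<close> have zero image in \<open>M/N\<close>, so projecting them away
      preserves classes there.\<close>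
  have "ZB \<rho> F t \<subseteq> D \<inter> (S + E)" if "t \<in> Seg" "t < (b, top.Value d)" for t
    using that
  proof (cases rule: segment_below_Value_cases)
    case (1 a c)
    have "cycles \<rho> (F a) \<subseteq> S"
      unfolding S_def using 1 by (intro cycles_subset_earlier_cycles)
    moreover have "cycles \<rho> (F a) \<subseteq> cycles \<rho> (F b)" "boundaries \<rho> (F c) \<subseteq> boundaries \<rho> (F d)"
      using 1 by (auto intro!: cycles_mono boundaries_mono monoD[OF mono] del: subsetI)
    ultimately show ?thesis
      using S_le 1 by (auto simp: D_def ZB_Value)
  next
    case (2 c)
    have "ZB \<rho> F (b, top.Value c) \<subseteq> E"
      unfolding E_def
      by (rule summand_subset_set_sum[where A = "\<lambda>d'. ZB \<rho> F (b, top.Value d')"])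
         (use 2 in \<open>auto simp: subspace_ZB\<close>)
    moreover have "boundaries \<rho> (F c) \<subseteq> boundaries \<rho> (F d)"
      using 2 by (auto intro!: boundaries_mono monoD[OF mono] del: subsetI)
    ultimately show ?thesis
      using E_le 2 by (auto simp: D_def ZB_Value)
  qed
  then have T_le: "T \<subseteq> D \<inter> (S + E)"
    unfolding T_def using sub by (intro set_sum_subset_subspace subspace_inter) auto
  have "D \<subseteq> chain_space \<rho> K"
    using chain_space_mono[OF FK] by (auto simp: D_def ZB_Value cycles_def)
  then have O': "O' = {x \<in> D. \<forall>y\<in>T. orthogonal y x}"
    by (auto simp: O'_def OI_def D_def T_def)
  have rep: "\<exists>x\<in>O'. v - x \<in> S + E" if "v \<in> S + D" for v
  proof -
    obtain s w where v: "v = s + w" "s \<in> S" "w \<in> D"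
      using \<open>v \<in> S + D\<close> by (rule set_plus_elim)
    \<comment> \<open>The summand \<open>s\<close> and the projection \<open>u\<close> of \<open>w\<close> to \<open>T\<close> both lie in \<open>S + E\<close>, so the class of
      \<open>v\<close> is represented by \<open>x\<close>.\<close>
    obtain u x where u: "u \<in> span T" and x: "\<And>y. y \<in> span T \<Longrightarrow> orthogonal x y" and w: "w = u + x"
      using orthogonal_subspace_decomp_exists[of T w] by metis
    have uT: "u \<in> T"
      using u span_minimal[OF order_refl sub(4)] by blast
    then have "x \<in> D"
      using subspace_diff[OF sub(2) v(3), of u] T_le w by auto
    then have "x \<in> O'"
      using x by (auto simp: O' orthogonal_commute span_base)
    moreover have "s + u \<in> S + E"
      using uT T_le S_le v(2) by (intro subspace_add[OF sub(5)]) auto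
    ultimately show ?thesis
      using v(1) w by (intro bexI[of _ x]) auto
  qed
  have "(\<lambda>v. v +o (S + E)) ` O' = (\<lambda>v. v +o (S + E)) ` (S + D)"
  proof
    show "(\<lambda>v. v +o (S + E)) ` O' \<subseteq> (\<lambda>v. v +o (S + E)) ` (S + D)"
      using D_le by (auto simp: O')
    show "(\<lambda>v. v +o (S + E)) ` (S + D) \<subseteq> (\<lambda>v. v +o (S + E)) ` O'"
      using rep coset_eq_iff_diff_mem[OF sub(5)] by (auto simp: image_iff)
  qed
  then have "(\<lambda>X. ?\<pi> ` X) ` (\<lambda>v. v +o (S + E)) ` O' = (\<lambda>X. ?\<pi> ` X) ` (\<lambda>v. v +o (S + E)) ` (S + D)"
    by (rule arg_cong)
  then show ?thesis
    by (simp add: O'_def[symmetric] P_space_def quotient_space_def M N image_image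
          homology_class_coset_image)
qed

end
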